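(* Let $f:\mathbb{R}^n\to\overline{\mathbb{R}}$ and let $\bar x\in\mathbb{R}^n$ be a point at which $f$ is finite and locally lsc. Let $0\le\theta<1$ and let $g(x):=(\max\{f(x)-f(\bar x),0\})^{1-\theta}$. Then $$\partial^{>}g(\bar x)=\limsup_{x\to_f\bar x,\ f(x)>f(\bar x)}\frac{(1-\theta)\,\partial f(x)}{(f(x)-f(\bar x))^{\theta}},$$ and the following hold: (a) $f$ satisfies the KL property at $\bar x$ with exponent $\theta$ if and only if $0\notin\partial^{>}g(\bar x)$. (b) If $\partial^{>}g(\bar x)\neq\emptyset$, then $0\in\partial^{>}\tilde g(\bar x)$ holds for all $\tilde g(x):=(\max\{f(x)-f(\bar x),0\})^{1-\tilde\theta}$ with $\tilde\theta<\theta$. (c) $f$ satisfies the KL property at $\bar x$ with a sharp exponent $\theta$ if $0\notin\partial^{>}g(\bar x)$ and $\partial^{>}g(\bar x)\neq\emptyset$. (d) $\mathrm{KL}(f,\bar x,\theta)=d\left(0,\partial^{>}g(\bar x)\right)$.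
   Context: $\overline{\mathbb{R}}=\mathbb{R}\cup\{\pm\infty\}$. $d(v,A)=\inf_{a\in A}\|a-v\|$, with $d(v,\emptyset)=+\infty$. A function $\varphi:\mathbb{R}^n\to\overline{\mathbb{R}}$ that is finite at $\bar x$ is locally lsc at $\bar x$ if $\operatorname{epi}\varphi$ is locally closed at $(\bar x,\varphi(\bar x))$; equivalently there is $\epsilon>0$ such that all sets $\{x:\|x-\bar x\|\le\epsilon,\ \varphi(x)\le\alpha\}$ with $\alpha\le\varphi(\bar x)+\epsilon$ are closed. Subgradients. Let $\varphi(x)$ be finite. $v\in\widehat\partial\varphi(x)$ (regular subgradient) if $\varphi(y)\ge\varphi(x)+\langle v,y-x\rangle+o(\|y-x\|)$. $v\in\partial\varphi(x)$ (limiting subgradient) if there are $x_k\to x$, $v_k\to v$ with $\varphi(x_k)\to\varphi(x)$ and $v_k\in\widehat\partial\varphi(x_k)$. $v\in\partial^{>}\varphi(x)$ (outer limiting subgradient) if there are $x_k\to x$, $v_k\to v$ with $\varphi(x_k)\to\varphi(x)$, $\varphi(x_k)>\varphi(x)$ and $v_k\in\partial\varphi(x_k)$. Subdifferentials are empty at points where $\varphi$ is not finite. $x\to_f\bar x$ means $x\to\bar x$ and $f(x)\to f(\bar x)$. The $\limsup$ of sets is the outer limit: the set of all limits $v=\lim_k v_k$ with $v_k$ in the set associated with $x_k$, for some sequence $x_k\to_f\bar x$ with $f(x_k)>f(\bar x)$. KL property. Let $\varphi$ be finite and locally lsc at $\bar x$. It satisfies the KL property at $\bar x$ with exponent $\theta\in[0,1)$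 and modulus $\mu>0$ if there exist $\epsilon>0$ and $\nu\in(0,+\infty]$ such that $d(0,\partial\varphi(x))\ge\frac{\mu}{1-\theta}(\max\{\varphi(x)-\varphi(\bar x),0\})^{\theta}$ whenever $\|x-\bar x\|\le\epsilon$ and $\varphi(x)<\varphi(\bar x)+\nu$ (with $0^0:=0$, so only points with $\varphi(x)>\varphi(\bar x)$ matter). "With exponent $\theta$" means for some modulus $\mu>0$. $\mathrm{KL}(\varphi,\bar x,\theta)$ is the supremum of all such $\mu$ ($\sup\emptyset:=0$); equivalently $\mathrm{KL}(\varphi,\bar x,\theta)=\liminf_{x\to_\varphi\bar x,\ \varphi(x)>\varphi(\bar x)}\frac{(1-\theta)d(0,\partial\varphi(x))}{(\varphi(x)-\varphi(\bar x))^{\theta}}$, set to $+\infty$ if there is no sequence $x_k\to\bar x$ with $\varphi(x_k)\to\varphi(\bar x)$, $\varphi(x_k)>\varphi(\bar x)$. Sharpness. $\theta\in(0,1)$ is a sharp KL exponent of $\varphi$ at $\bar x$ if $\varphi$ satisfies the KL property at $\bar x$ with exponent $\theta$ but not with any exponent $\theta'\in[0,\theta)$. The exponent $0$ is sharp if $\varphi$ satisfies the KL property at $\bar x$ with exponent $0$ and $\partial^{>}\varphi(\bar x)\neq\emptyset$. *)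

theory Defs
  imports "HOL-Analysis.Analysis" "HOL-Library.Landau_Symbols"
begin

text \<open>Unlike \<^const>\<open>infdist\<close>, this is \<open>\<infinity>\<close> for the empty set.\<close>
definition set_distance :: "'a::real_normed_vector \<Rightarrow> 'a set \<Rightarrow> ereal" where
  "set_distance v A = (INF a\<in>A. ereal (norm (a - v)))"

text \<open>Meant for \<open>t \<ge> 0\<close>, with \<open>\<infinity>\<close> only raised to positive powers.
  As \<open>0 powr 0 = 0\<close>, the convention \<open>0\<^sup>0 = 0\<close> is built in.\<close>
definition ereal_powr :: "ereal \<Rightarrow> real \<Rightarrow> ereal" where
  "ereal_powr t p = (if t = \<infinity> then \<infinity> else ereal (real_of_ereal t powr p))"

definition epigraph :: "('a \<Rightarrow> ereal) \<Rightarrow> ('a \<times> real) set" where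
  "epigraph \<phi> = {(x, \<alpha>). \<phi> x \<le> ereal \<alpha>}"

definition locally_closed_at :: "'a::topological_space set \<Rightarrow> 'a \<Rightarrow> bool" where
  "locally_closed_at C p \<longleftrightarrow> (\<exists>V. closed V \<and> p \<in> interior V \<and> closed (C \<inter> V))"

definition locally_lsc_at :: "('a::topological_space \<Rightarrow> ereal) \<Rightarrow> 'a \<Rightarrow> bool" where
  "locally_lsc_at \<phi> x \<longleftrightarrow>
     \<bar>\<phi> x\<bar> \<noteq> \<infinity> \<and> locally_closed_at (epigraph \<phi>) (x, real_of_ereal (\<phi> x))"

definition regular_subdifferential ::
    "('a::real_inner \<Rightarrow> ereal) \<Rightarrow> 'a \<Rightarrow> 'a set" where
  "regular_subdifferential \<phi> x =
     {v. \<bar>\<phi> x\<bar> \<noteq> \<infinity> \<and>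
         (\<exists>r. r \<in> o[nhds x](\<lambda>y. norm (y - x)) \<and>
              (\<forall>\<^sub>F y in nhds x. \<phi> y \<ge> \<phi> x + ereal (v \<bullet> (y - x)) + ereal (r y)))}"

definition limiting_subdifferential ::
    "('a::real_inner \<Rightarrow> ereal) \<Rightarrow> 'a \<Rightarrow> 'a set" where
  "limiting_subdifferential \<phi> x =
     {v. \<bar>\<phi> x\<bar> \<noteq> \<infinity> \<and>
         (\<exists>X V. X \<longlonglongrightarrow> x \<and> (\<lambda>k. \<phi> (X k)) \<longlonglongrightarrow> \<phi> x \<and> V \<longlonglongrightarrow> v \<and>
                (\<forall>k. V k \<in> regular_subdifferential \<phi> (X k)))}"

text \<open>Outer limit of the sets \<open>S x'\<close> as \<open>x' \<rightarrow> x\<close>, \<open>\<phi> x' \<rightarrow> \<phi> x\<close>, \<open>\<phi> x' > \<phi> x\<close>.\<close>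
definition limsup_from_above ::
    "('a::topological_space \<Rightarrow> ereal) \<Rightarrow> 'a \<Rightarrow> ('a \<Rightarrow> 'b::topological_space set) \<Rightarrow> 'b set" where
  "limsup_from_above \<phi> x S =
     {v. \<exists>X V. X \<longlonglongrightarrow> x \<and> (\<lambda>k. \<phi> (X k)) \<longlonglongrightarrow> \<phi> x \<and> (\<forall>k. \<phi> (X k) > \<phi> x) \<and>
               V \<longlonglongrightarrow> v \<and> (\<forall>k. V k \<in> S (X k))}"

definition outer_subdifferential ::
    "('a::real_inner \<Rightarrow> ereal) \<Rightarrow> 'a \<Rightarrow> 'a set" where
  "outer_subdifferential \<phi> x =
     (if \<bar>\<phi> x\<bar> \<noteq> \<infinity> then limsup_from_above \<phi> x (limiting_subdifferential \<phi>) else {})"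

definition KL_property ::
    "('a::real_inner \<Rightarrow> ereal) \<Rightarrow> 'a \<Rightarrow> real \<Rightarrow> real \<Rightarrow> bool" where
  "KL_property \<phi> x0 \<theta> \<mu> \<longleftrightarrow>
     locally_lsc_at \<phi> x0 \<and> 0 \<le> \<theta> \<and> \<theta> < 1 \<and> \<mu> > 0 \<and>
     (\<exists>\<epsilon>>0. \<exists>\<nu>::ereal. \<nu> > 0 \<and>
        (\<forall>x. norm (x - x0) \<le> \<epsilon> \<and> \<phi> x < \<phi> x0 + \<nu> \<longrightarrow>
           set_distance 0 (limiting_subdifferential \<phi> x)
             \<ge> ereal (\<mu> / (1 - \<theta>)) * ereal_powr (max (\<phi> x - \<phi> x0) 0) \<theta>))"

definition KL_exponent :: "('a::real_inner \<Rightarrow> ereal) \<Rightarrow> 'a \<Rightarrow> real \<Rightarrow> bool" where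
  "KL_exponent \<phi> x0 \<theta> \<longleftrightarrow> (\<exists>\<mu>. KL_property \<phi> x0 \<theta> \<mu>)"

text \<open>All moduli are positive, so inserting \<open>0\<close> only makes the supremum of the empty set \<open>0\<close>.\<close>
definition KL_modulus :: "('a::real_inner \<Rightarrow> ereal) \<Rightarrow> 'a \<Rightarrow> real \<Rightarrow> ereal" where
  "KL_modulus \<phi> x0 \<theta> = Sup (insert 0 {ereal \<mu> |\<mu>. KL_property \<phi> x0 \<theta> \<mu>})"

definition sharp_KL_exponent :: "('a::real_inner \<Rightarrow> ereal) \<Rightarrow> 'a \<Rightarrow> real \<Rightarrow> bool" where
  "sharp_KL_exponent \<phi> x0 \<theta> \<longleftrightarrow>
     KL_exponent \<phi> x0 \<theta> \<and>
     (if \<theta> = 0 then outer_subdifferential \<phi> x0 \<noteq> {}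
      else \<forall>\<theta>'. 0 \<le> \<theta>' \<and> \<theta>' < \<theta> \<longrightarrow> \<not> KL_exponent \<phi> x0 \<theta>')"

end

theory Submission
  imports Defs
begin

text \<open>
  Put \<open>c = f(xbar)\<close>, \<open>p = 1 - \<theta>\<close> and \<open>h(t) = (t - c)\<^sup>p\<close>.  On \<open>t > c\<close> the function \<open>h\<close> is increasing and
  continuously differentiable with a positive derivative, and its inverse has the same
  properties.  Composition with such a function multiplies subgradients by the derivative; for the
  inequality that defines a regular subgradient this is a first-order expansion, and it passes to
  limiting subgradients because the derivative is continuous.  A regular subgradient forces
  lower semicontinuity at its own point, so \<open>f > c\<close> (equivalently \<open>g > 0\<close>) persists nearby and the
  truncation in \<open>g\<close> is invisible.  Using the
  rule for \<open>h\<close> and for its inverse gives the equality \<open>\<partial>g(x) = h'(f(x)) \<partial>f(x)\<close> wherever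
  \<open>f(x) > f(xbar)\<close> (lemma \<open>limiting_subdifferential_power_above\<close>), and the formula for the outer
  subdifferential of \<open>g\<close> follows since \<open>g(x) \<rightarrow> 0\<close> means \<open>f(x) \<rightarrow> f(xbar)\<close> along such points.

  After multiplication by \<open>h'(f(x))\<close> the KL inequality with modulus \<open>\<mu>\<close> says precisely that all
  subgradients of \<open>g\<close> at points just above \<open>xbar\<close> have norm at least \<open>\<mu>\<close>.  So it bounds the outer
  subgradients of \<open>g\<close> from below (\<open>KL_property_imp_le_norm\<close>).  Conversely, failure of the inequality
  for moduli \<open>\<mu>\<^sub>k \<rightarrow> m\<close>, on neighbourhoods that shrink with \<open>k\<close>, yields a bounded sequence of
  subgradients, and a cluster point is an outer subgradient of norm at most \<open>m\<close>
  (\<open>not_KL_property_imp_outer_subgradient\<close>).  With \<open>m = 0\<close> this is (a), with constant \<open>\<mu>\<^sub>k\<close> it is (d).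
  For (b), raising the exponent from \<open>p\<close> to \<open>q > p\<close> multiplies the subgradients by
  \<open>(q/p) (f(x) - c)\<^bsup>q-p\<^esup>\<close>, which tends to \<open>0\<close>; (c) combines (a) and (b).
\<close>

section \<open>A chain rule for increasing outer functions\<close>

text \<open>The only link between \<open>\<phi>\<close> and \<open>\<psi>\<close> away from \<open>x\<close> is that lower bounds above the level \<open>l\<close>
  transfer through \<open>h\<close>.  That is enough because \<open>\<phi> x + v \<bullet> (y - x) + r y\<close> exceeds \<open>l\<close> near \<open>x\<close>, and
  \<open>h\<close> of this quantity has the expansion that makes \<open>d *\<^sub>R v\<close> a subgradient.  A truncated power
  transfers lower bounds in this way, and so does its inverse.\<close>

lemma regular_subdifferential_compose:
  fixes \<phi> \<psi> :: "'a::real_inner \<Rightarrow> ereal" and h :: "real \<Rightarrow> real"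
  assumes v: "v \<in> regular_subdifferential \<phi> x"
    and s: "\<phi> x = ereal s" "l < s"
    and \<psi>x: "\<psi> x = ereal (h s)"
    and transfer: "\<And>y t. l < t \<Longrightarrow> ereal t \<le> \<phi> y \<Longrightarrow> ereal (h t) \<le> \<psi> y"
    and deriv: "(h has_real_derivative d) (at s)"
  shows "d *\<^sub>R v \<in> regular_subdifferential \<psi> x"
proof -
  from v obtain r where r: "r \<in> o[nhds x](\<lambda>y. norm (y - x))"
    and ev: "\<forall>\<^sub>F y in nhds x. \<phi> y \<ge> \<phi> x + ereal (v \<bullet> (y - x)) + ereal (r y)"
    unfolding regular_subdifferential_def by blast
  define t where "t y = s + v \<bullet> (y - x) + r y" for y
  define \<rho> where "\<rho> y = h (t y) - h s - d * (v \<bullet> (y - x))" for y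
  have rbound: "\<forall>\<^sub>F y in nhds x. \<bar>r y\<bar> \<le> e * norm (y - x)" if "e > 0" for e
    using landau_o.smallD[OF r that] by simp
  have tbound: "\<forall>\<^sub>F y in nhds x. \<bar>t y - s\<bar> \<le> (norm v + 1) * norm (y - x)"
    using rbound[of 1, simplified]
  proof eventually_elim
    case (elim y)
    have "\<bar>t y - s\<bar> \<le> \<bar>v \<bullet> (y - x)\<bar> + \<bar>r y\<bar>" by (simp add: t_def)
    also have "\<dots> \<le> norm v * norm (y - x) + norm (y - x)"
      using elim Cauchy_Schwarz_ineq2[of v "y - x"] by linarith
    finally show ?case by (simp add: algebra_simps)
  qed
  have tlim: "(t \<longlongrightarrow> s) (nhds x)"
  proof -
    have "((\<lambda>y. (norm v + 1) * norm (y - x)) \<longlongrightarrow> (norm v + 1) * norm (x - x)) (nhds x)"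
      by (intro tendsto_intros filterlim_ident)
    hence "((\<lambda>y. t y - s) \<longlongrightarrow> 0) (nhds x)"
      using tbound by (intro Lim_null_comparison[of "\<lambda>y. t y - s"]) simp_all
    thus ?thesis by (simp add: LIM_zero_iff)
  qed
  have "\<rho> \<in> o[nhds x](\<lambda>y. norm (y - x))"
  proof (rule landau_o.smallI)
    fix e :: real assume e: "e > 0"
    define e1 where "e1 = e / (2 * (norm v + 1))"
    define e2 where "e2 = e / (2 * (\<bar>d\<bar> + 1))"
    have n: "norm v + 1 > 0" by (simp add: add_nonneg_pos)
    have e1: "e1 > 0" and e2: "e2 > 0" using e n by (simp_all add: e1_def e2_def)
    have "(h has_derivative (*) d) (at s)"
      using deriv by (simp add: has_field_derivative_def)
    then obtain \<delta> where \<delta>: "\<delta> > 0"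
      and hd: "\<And>u. norm (u - s) < \<delta> \<Longrightarrow> norm (h u - h s - d * (u - s)) \<le> e1 * norm (u - s)"
      using e1 unfolding has_derivative_at_alt by blast
    have "\<forall>\<^sub>F y in nhds x. dist (t y) s < \<delta>" using tlim \<delta> by (rule tendstoD)
    thus "\<forall>\<^sub>F y in nhds x. norm (\<rho> y) \<le> e * norm (norm (y - x))"
      using tbound rbound[OF e2]
    proof eventually_elim
      case (elim y)
      let ?N = "norm (y - x)"
      have a: "\<bar>h (t y) - h s - d * (t y - s)\<bar> \<le> e1 * \<bar>t y - s\<bar>"
        using hd[of "t y"] elim(1) by (simp add: dist_norm)
      also have "\<dots> \<le> e1 * ((norm v + 1) * ?N)" using elim(2) e1 by simp
      also have "\<dots> = e / 2 * ?N" using n by (simp add: e1_def field_simps)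
      finally have a: "\<bar>h (t y) - h s - d * (t y - s)\<bar> \<le> e / 2 * ?N" .
      have "\<bar>d * r y\<bar> \<le> (\<bar>d\<bar> + 1) * (e2 * ?N)"
        unfolding abs_mult by (rule mult_mono) (use elim(3) in auto)
      also have "\<dots> = e / 2 * ?N" by (simp add: e2_def field_simps)
      finally have b: "\<bar>d * r y\<bar> \<le> e / 2 * ?N" .
      have "\<rho> y = (h (t y) - h s - d * (t y - s)) + d * r y"
        by (simp add: \<rho>_def t_def algebra_simps)
      hence "\<bar>\<rho> y\<bar> \<le> e / 2 * ?N + e / 2 * ?N" using a b by linarith
      thus ?case by simp
    qed
  qed
  moreover have "\<forall>\<^sub>F y in nhds x. \<psi> y \<ge> \<psi> x + ereal ((d *\<^sub>R v) \<bullet> (y - x)) + ereal (\<rho> y)"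
    using ev order_tendstoD(1)[OF tlim s(2)]
  proof eventually_elim
    case (elim y)
    hence "ereal (h (t y)) \<le> \<psi> y" by (intro transfer) (auto simp: s t_def)
    thus ?case by (simp add: \<psi>x \<rho>_def)
  qed
  ultimately show ?thesis unfolding regular_subdifferential_def using \<psi>x by auto
qed

lemma limiting_subdifferential_compose:
  fixes \<phi> \<psi> :: "'a::real_inner \<Rightarrow> ereal" and h h' :: "real \<Rightarrow> real"
  assumes v: "v \<in> limiting_subdifferential \<phi> x"
    and s: "\<phi> x = ereal s" "l < s"
    and eq: "\<And>y t. l < t \<Longrightarrow> \<phi> y = ereal t \<Longrightarrow> \<psi> y = ereal (h t)"
    and transfer: "\<And>y t. l < t \<Longrightarrow> ereal t \<le> \<phi> y \<Longrightarrow> ereal (h t) \<le> \<psi> y"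
    and deriv: "\<And>t. l < t \<Longrightarrow> (h has_real_derivative h' t) (at t)"
    and cont: "isCont h' s"
  shows "h' s *\<^sub>R v \<in> limiting_subdifferential \<psi> x"
proof -
  from v obtain X V where X: "X \<longlonglongrightarrow> x" and \<phi>X: "(\<lambda>k. \<phi> (X k)) \<longlonglongrightarrow> \<phi> x" and V: "V \<longlonglongrightarrow> v"
    and VX: "\<And>k. V k \<in> regular_subdifferential \<phi> (X k)"
    unfolding limiting_subdifferential_def by blast
  define a where "a k = real_of_ereal (\<phi> (X k))" for k
  have a: "\<phi> (X k) = ereal (a k)" for k
    using VX[of k] unfolding regular_subdifferential_def a_def by (auto simp: ereal_real)
  have alim: "a \<longlonglongrightarrow> s" using \<phi>X by (simp add: a s)
  \<comment> \<open>The values are above the level only from some index on, so the sequences are shifted.\<close>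
  obtain N where N: "\<And>k. k \<ge> N \<Longrightarrow> l < a k"
    using order_tendstoD(1)[OF alim s(2)] unfolding eventually_sequentially by blast
  have aN: "(\<lambda>k. a (k + N)) \<longlonglongrightarrow> s" using alim by (rule LIMSEQ_ignore_initial_segment)
  have "isCont h s" using deriv[OF s(2)] by (rule DERIV_isCont)
  hence "(\<lambda>k. h (a (k + N))) \<longlonglongrightarrow> h s" using aN by (rule isCont_tendsto_compose)
  moreover have \<psi>: "\<psi> (X (k + N)) = ereal (h (a (k + N)))" for k by (rule eq) (auto simp: N a)
  moreover have \<psi>x: "\<psi> x = ereal (h s)" by (rule eq) (auto simp: s)
  ultimately have 1: "(\<lambda>k. \<psi> (X (k + N))) \<longlonglongrightarrow> \<psi> x" by simp
  have 2: "(\<lambda>k. h' (a (k + N)) *\<^sub>R V (k + N)) \<longlonglongrightarrow> h' s *\<^sub>R v"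
    by (intro tendsto_scaleR isCont_tendsto_compose[OF cont aN] LIMSEQ_ignore_initial_segment V)
  have "h' (a (k + N)) *\<^sub>R V (k + N) \<in> regular_subdifferential \<psi> (X (k + N))" for k
    by (rule regular_subdifferential_compose[where l = l and h = h, OF VX a])
       (auto simp: N \<psi> deriv intro: transfer)
  moreover have "\<bar>\<psi> x\<bar> \<noteq> \<infinity>" by (simp add: \<psi>x)
  ultimately show ?thesis unfolding limiting_subdifferential_def
    using 1 2 LIMSEQ_ignore_initial_segment[OF X, of N] by blast
qed

section \<open>Powers of the excess over a level\<close>

definition power_above :: "('a \<Rightarrow> ereal) \<Rightarrow> ereal \<Rightarrow> real \<Rightarrow> 'a \<Rightarrow> ereal" where
  "power_above \<phi> c p x = ereal_powr (max (\<phi> x - c) 0) p"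

lemma power_above_eq:
  assumes "\<phi> x = ereal t" "c \<le> t"
  shows "power_above \<phi> (ereal c) p x = ereal ((t - c) powr p)"
  using assms by (simp add: power_above_def ereal_powr_def max_def zero_ereal_def)

lemma power_above_infinite:
  assumes "\<phi> x = \<infinity>"
  shows "power_above \<phi> (ereal c) p x = \<infinity>"
  using assms by (simp add: power_above_def ereal_powr_def max_def)

lemma power_above_below:
  assumes "\<phi> x \<le> ereal c"
  shows "power_above \<phi> (ereal c) p x = 0"
proof -
  have "\<phi> x - ereal c \<le> 0" using assms by (cases "\<phi> x") (auto simp: zero_ereal_def)
  thus ?thesis by (simp add: power_above_def ereal_powr_def max_absorb2 zero_ereal_def)
qed

lemma power_above_pos_iff: "0 < power_above \<phi> (ereal c) p x \<longleftrightarrow> ereal c < \<phi> x"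
proof (cases "\<phi> x \<le> ereal c")
  case True
  thus ?thesis by (simp add: power_above_below)
next
  case False
  thus ?thesis by (cases "\<phi> x") (auto simp: power_above_eq power_above_infinite)
qed

lemma limiting_subdifferential_infinite:
  "\<bar>\<phi> x\<bar> = \<infinity> \<Longrightarrow> limiting_subdifferential \<phi> x = {}"
  by (simp add: limiting_subdifferential_def)

lemma limiting_subdifferential_power_above:
  fixes \<phi> :: "'a::real_inner \<Rightarrow> ereal"
  assumes p: "p > 0" and x: "ereal c < \<phi> x"
  shows "limiting_subdifferential (power_above \<phi> (ereal c) p) x =
    (\<lambda>v. (p * real_of_ereal (\<phi> x - ereal c) powr (p - 1)) *\<^sub>R v) ` limiting_subdifferential \<phi> x"
    (is "limiting_subdifferential ?\<psi> x = _")
proof (cases "\<phi> x")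
  case (real s)
  with x have s: "c < s" by simp
  define \<sigma> where "\<sigma> = (s - c) powr p"
  define d where "d = p * (s - c) powr (p - 1)"
  define d' where "d' = 1 / p * \<sigma> powr (1 / p - 1)"
  have \<sigma>: "0 < \<sigma>" using s by (simp add: \<sigma>_def)
  have \<psi>x: "?\<psi> x = ereal \<sigma>" using s real by (simp add: power_above_eq \<sigma>_def)
  have fwd: "d *\<^sub>R v \<in> limiting_subdifferential ?\<psi> x" if "v \<in> limiting_subdifferential \<phi> x" for v
    unfolding d_def
  proof (rule limiting_subdifferential_compose[where l = c and s = s
        and h = "\<lambda>t. (t - c) powr p" and h' = "\<lambda>t. p * (t - c) powr (p - 1)", OF that real s])
    show "?\<psi> y = ereal ((t - c) powr p)" if "c < t" "\<phi> y = ereal t" for y t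
      using that by (simp add: power_above_eq)
    show "ereal ((t - c) powr p) \<le> ?\<psi> y" if "c < t" "ereal t \<le> \<phi> y" for y t
      using that p by (cases "\<phi> y") (auto simp: power_above_eq power_above_infinite intro!: powr_mono2)
    show "((\<lambda>t. (t - c) powr p) has_real_derivative p * (t - c) powr (p - 1)) (at t)"
      if "c < t" for t
      using that by (auto intro!: derivative_eq_intros)
    show "isCont (\<lambda>t. p * (t - c) powr (p - 1)) s"
      using s by (intro continuous_intros) auto
  qed
  \<comment> \<open>The inverse of the power is applied to \<open>?\<psi>\<close>; on positive values it recovers \<open>\<phi>\<close>.\<close>
  have bwd: "d' *\<^sub>R w \<in> limiting_subdifferential \<phi> x" if "w \<in> limiting_subdifferential ?\<psi> x" for w
    unfolding d'_def
  proof (rule limiting_subdifferential_compose[where l = 0 and s = \<sigma>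
        and h = "\<lambda>t. c + t powr (1 / p)" and h' = "\<lambda>t. 1 / p * t powr (1 / p - 1)", OF that \<psi>x \<sigma>])
    show "\<phi> y = ereal (c + t powr (1 / p))" if t: "0 < t" and y: "?\<psi> y = ereal t" for y t
    proof -
      have "ereal c < \<phi> y" using t y power_above_pos_iff[of \<phi> c p y] by simp
      then obtain u where "\<phi> y = ereal u" "c < u"
        using y by (cases "\<phi> y") (auto simp: power_above_infinite)
      thus ?thesis using y p by (auto simp: power_above_eq powr_powr)
    qed
    show "ereal (c + t powr (1 / p)) \<le> \<phi> y" if t: "0 < t" and y: "ereal t \<le> ?\<psi> y" for y t
    proof -
      have "0 < ?\<psi> y" using t y by (meson ereal_less(2) less_le_trans)
      hence y': "ereal c < \<phi> y" by (simp add: power_above_pos_iff)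
      show ?thesis
      proof (cases "\<phi> y")
        case (real u)
        hence "c < u" "t \<le> (u - c) powr p" using y y' by (auto simp: power_above_eq)
        hence "t powr (1 / p) \<le> ((u - c) powr p) powr (1 / p)"
          using t p by (intro powr_mono2) auto
        thus ?thesis using p \<open>c < u\<close> by (simp add: powr_powr real)
      qed (use y' in auto)
    qed
    show "((\<lambda>t. c + t powr (1 / p)) has_real_derivative 1 / p * t powr (1 / p - 1)) (at t)"
      if "0 < t" for t
      using that by (auto intro!: derivative_eq_intros)
    show "isCont (\<lambda>t. 1 / p * t powr (1 / p - 1)) \<sigma>"
      using \<sigma> by (intro continuous_intros) auto
  qed
  have "d * d' = (s - c) powr (p - 1) * (s - c) powr (p * (1 / p - 1))"
    using p by (simp add: d_def d'_def \<sigma>_def powr_powr)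
  also have "\<dots> = (s - c) powr ((p - 1) + p * (1 / p - 1))" by (simp only: powr_add)
  also have "(p - 1) + p * (1 / p - 1) = 0" using p by (simp add: field_simps)
  finally have dd': "d * d' = 1" using s by simp
  have "w \<in> (\<lambda>v. d *\<^sub>R v) ` limiting_subdifferential \<phi> x"
    if "w \<in> limiting_subdifferential ?\<psi> x" for w
    by (rule image_eqI[OF _ bwd[OF that]]) (simp add: dd')
  hence "limiting_subdifferential ?\<psi> x = (\<lambda>v. d *\<^sub>R v) ` limiting_subdifferential \<phi> x"
    using fwd by blast
  thus ?thesis by (simp add: real d_def)
next
  case PInf
  hence "limiting_subdifferential \<phi> x = {}" by (simp add: limiting_subdifferential_infinite)
  moreover have "limiting_subdifferential ?\<psi> x = {}"
    by (rule limiting_subdifferential_infinite) (simp add: power_above_infinite[of \<phi>, OF PInf])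
  ultimately show ?thesis by simp
next
  case MInf
  thus ?thesis using x by simp
qed

lemma power_above_tendsto_iff:
  assumes p: "p > 0" and a: "\<And>k. \<phi> (X k) = ereal (a k)" "\<And>k. c < a k"
  shows "(\<lambda>k. power_above \<phi> (ereal c) p (X k)) \<longlonglongrightarrow> 0 \<longleftrightarrow> (\<lambda>k. \<phi> (X k)) \<longlonglongrightarrow> ereal c"
proof -
  have powr_null: "(\<lambda>k. b k powr q) \<longlonglongrightarrow> 0" if "b \<longlonglongrightarrow> 0" "\<And>k. 0 \<le> b k" "q > 0" for b and q :: real
    using tendsto_powr'[OF that(1) tendsto_const[of q]] that by simp
  have "(\<lambda>k. (a k - c) powr p) \<longlonglongrightarrow> 0 \<longleftrightarrow> (\<lambda>k. a k - c) \<longlonglongrightarrow> 0"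
  proof
    assume "(\<lambda>k. (a k - c) powr p) \<longlonglongrightarrow> 0"
    hence "(\<lambda>k. ((a k - c) powr p) powr (1 / p)) \<longlonglongrightarrow> 0" by (rule powr_null) (use p in auto)
    moreover have "((a k - c) powr p) powr (1 / p) = a k - c" for k
      using p a(2)[of k] by (simp add: powr_powr)
    ultimately show "(\<lambda>k. a k - c) \<longlonglongrightarrow> 0" by simp
  next
    assume "(\<lambda>k. a k - c) \<longlonglongrightarrow> 0"
    thus "(\<lambda>k. (a k - c) powr p) \<longlonglongrightarrow> 0" by (rule powr_null) (use p a(2) in \<open>auto simp: less_imp_le\<close>)
  qed
  moreover have "power_above \<phi> (ereal c) p (X k) = ereal ((a k - c) powr p)" for k
    using a[of k] by (intro power_above_eq) auto
  ultimately show ?thesis by (simp add: a(1) zero_ereal_def LIM_zero_iff)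
qed

text \<open>The factor is the derivative of \<open>u\<^sup>p\<close> at the excess \<open>u = \<phi> x - \<phi> x0\<close>, so by the chain rule this is
  the limiting subdifferential of the power at points above the level \<open>\<phi> x0\<close>.\<close>

definition scaled_subdifferential :: "('a::real_inner \<Rightarrow> ereal) \<Rightarrow> 'a \<Rightarrow> real \<Rightarrow> 'a \<Rightarrow> 'a set" where
  "scaled_subdifferential \<phi> x0 p x =
     (\<lambda>v. (p * real_of_ereal (\<phi> x - \<phi> x0) powr (p - 1)) *\<^sub>R v) ` limiting_subdifferential \<phi> x"

lemma finite_if_scaled_subgradient:
  "w \<in> scaled_subdifferential \<phi> x0 p x \<Longrightarrow> \<bar>\<phi> x\<bar> \<noteq> \<infinity>"
  by (auto simp: scaled_subdifferential_def limiting_subdifferential_def)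

lemma outer_subdifferential_power_above:
  fixes \<phi> :: "'a::real_inner \<Rightarrow> ereal"
  assumes p: "p > 0" and fin: "\<bar>\<phi> x0\<bar> \<noteq> \<infinity>"
  shows "outer_subdifferential (power_above \<phi> (\<phi> x0) p) x0 =
    limsup_from_above \<phi> x0 (scaled_subdifferential \<phi> x0 p)"
proof -
  obtain c where c: "\<phi> x0 = ereal c" using fin by auto
  let ?g = "power_above \<phi> (ereal c) p"
  have g0: "?g x0 = 0" by (simp add: power_above_below c)
  have "X \<longlonglongrightarrow> x0 \<and> (\<lambda>k. ?g (X k)) \<longlonglongrightarrow> 0 \<and> (\<forall>k. ?g (X k) > 0) \<and> V \<longlonglongrightarrow> v \<and>
           (\<forall>k. V k \<in> limiting_subdifferential ?g (X k)) \<longleftrightarrow>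
         X \<longlonglongrightarrow> x0 \<and> (\<lambda>k. \<phi> (X k)) \<longlonglongrightarrow> ereal c \<and> (\<forall>k. \<phi> (X k) > ereal c) \<and> V \<longlonglongrightarrow> v \<and>
           (\<forall>k. V k \<in> scaled_subdifferential \<phi> x0 p (X k))" for X V v
  proof (cases "\<forall>k. ereal c < \<phi> (X k) \<and> V k \<in> scaled_subdifferential \<phi> x0 p (X k)")
    case True
    hence a: "\<phi> (X k) = ereal (real_of_ereal (\<phi> (X k)))" "c < real_of_ereal (\<phi> (X k))" for k
      using finite_if_scaled_subgradient[of "V k" \<phi> x0 p "X k"]
      by (cases "\<phi> (X k)"; simp; metis less_ereal.simps(1))+
    hence "(\<lambda>k. ?g (X k)) \<longlonglongrightarrow> 0 \<longleftrightarrow> (\<lambda>k. \<phi> (X k)) \<longlonglongrightarrow> ereal c"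
      by (rule power_above_tendsto_iff[OF p])
    moreover have "?g (X k) > 0" "V k \<in> limiting_subdifferential ?g (X k)" for k
      using True
      by (simp_all add: power_above_pos_iff limiting_subdifferential_power_above[OF p]
          scaled_subdifferential_def c)
    ultimately show ?thesis using True by blast
  next
    case False
    thus ?thesis
      by (auto simp: power_above_pos_iff limiting_subdifferential_power_above[OF p]
          scaled_subdifferential_def c)
  qed
  thus ?thesis by (simp add: outer_subdifferential_def limsup_from_above_def c g0)
qed

text \<open>An outer subgradient for the power \<open>p\<close> is a limit of \<open>p t\<^bsup>p-1\<^esup> v\<close> with \<open>t \<rightarrow> 0\<close>; passing to
  the power \<open>q\<close> inserts the vanishing factor \<open>(q/p) t\<^bsup>q-p\<^esup>\<close>.\<close>

lemma zero_in_limsup_scaled_subdifferential: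
  fixes \<phi> :: "'a::real_inner \<Rightarrow> ereal"
  assumes p: "0 < p" "p < q" and fin: "\<bar>\<phi> x0\<bar> \<noteq> \<infinity>"
    and ne: "limsup_from_above \<phi> x0 (scaled_subdifferential \<phi> x0 p) \<noteq> {}"
  shows "0 \<in> limsup_from_above \<phi> x0 (scaled_subdifferential \<phi> x0 q)"
proof -
  obtain c where c: "\<phi> x0 = ereal c" using fin by auto
  from ne obtain w X V where X: "X \<longlonglongrightarrow> x0" "(\<lambda>k. \<phi> (X k)) \<longlonglongrightarrow> \<phi> x0" "\<forall>k. \<phi> (X k) > \<phi> x0"
    and V: "V \<longlonglongrightarrow> w" and VX: "\<And>k. V k \<in> scaled_subdifferential \<phi> x0 p (X k)"
    unfolding limsup_from_above_def by blast
  define t where "t k = real_of_ereal (\<phi> (X k)) - c" for k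
  have \<phi>X: "\<phi> (X k) = ereal (c + t k)" for k
    using finite_if_scaled_subgradient[OF VX[of k]] by (auto simp: t_def)
  have tpos: "0 < t k" for k using X(3) by (simp add: \<phi>X c)
  have "(\<lambda>k. c + t k) \<longlonglongrightarrow> c + 0" using X(2) by (simp add: \<phi>X c)
  hence "t \<longlonglongrightarrow> 0" by (simp only: tendsto_add_const_iff)
  hence "(\<lambda>k. t k powr (q - p)) \<longlonglongrightarrow> 0"
    using tendsto_powr'[of t 0 sequentially "\<lambda>_. q - p" "q - p"] p tpos by (simp add: less_imp_le)
  hence "(\<lambda>k. (q / p * t k powr (q - p)) *\<^sub>R V k) \<longlonglongrightarrow> (q / p * 0) *\<^sub>R w"
    by (intro tendsto_intros V)
  moreover have "(q / p * t k powr (q - p)) *\<^sub>R V k \<in> scaled_subdifferential \<phi> x0 q (X k)" for k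
  proof -
    obtain v where v: "v \<in> limiting_subdifferential \<phi> (X k)" and "V k = (p * t k powr (p - 1)) *\<^sub>R v"
      using VX[of k] by (auto simp: scaled_subdifferential_def \<phi>X c)
    hence "(q / p * t k powr (q - p)) *\<^sub>R V k = (q * (t k powr (q - p) * t k powr (p - 1))) *\<^sub>R v"
      using p by simp
    also have "t k powr (q - p) * t k powr (p - 1) = t k powr (q - 1)"
      by (simp flip: powr_add)
    finally show ?thesis using v by (auto simp: scaled_subdifferential_def \<phi>X c)
  qed
  ultimately show ?thesis using X unfolding limsup_from_above_def scaleR_zero_left mult_zero_right
    by blast
qed

section \<open>The KL inequality and outer subgradients\<close>

lemma set_distance_nonneg: "0 \<le> set_distance v A"
  by (simp add: set_distance_def INF_greatest)

lemma KL_property_imp_le_norm: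
  fixes \<phi> :: "'a::real_inner \<Rightarrow> ereal"
  assumes KL: "KL_property \<phi> x0 \<theta> \<mu>"
    and w: "w \<in> limsup_from_above \<phi> x0 (scaled_subdifferential \<phi> x0 (1 - \<theta>))"
  shows "\<mu> \<le> norm w"
proof -
  have \<theta>: "0 \<le> \<theta>" "\<theta> < 1" and \<mu>: "\<mu> > 0" using KL by (auto simp: KL_property_def)
  obtain c where c: "\<phi> x0 = ereal c"
    using KL by (auto simp: KL_property_def locally_lsc_at_def)
  from KL obtain \<epsilon> and \<nu> :: ereal where "\<epsilon> > 0" "\<nu> > 0" and ineq:
    "\<And>x. norm (x - x0) \<le> \<epsilon> \<Longrightarrow> \<phi> x < \<phi> x0 + \<nu> \<Longrightarrow> set_distance 0 (limiting_subdifferential \<phi> x)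
             \<ge> ereal (\<mu> / (1 - \<theta>)) * ereal_powr (max (\<phi> x - \<phi> x0) 0) \<theta>"
    unfolding KL_property_def by blast
  from w obtain X V where X: "X \<longlonglongrightarrow> x0" "(\<lambda>k. \<phi> (X k)) \<longlonglongrightarrow> \<phi> x0" "\<And>k. \<phi> (X k) > \<phi> x0"
    and V: "V \<longlonglongrightarrow> w" and VX: "\<And>k. V k \<in> scaled_subdifferential \<phi> x0 (1 - \<theta>) (X k)"
    unfolding limsup_from_above_def by blast
  have "\<phi> x0 < \<phi> x0 + \<nu>" using \<open>\<nu> > 0\<close> c by (cases \<nu>) auto
  hence "\<forall>\<^sub>F k in sequentially. \<phi> (X k) < \<phi> x0 + \<nu>" using X(2) by (intro order_tendstoD)
  moreover have "\<forall>\<^sub>F k in sequentially. dist (X k) x0 < \<epsilon>" using X(1) \<open>\<epsilon> > 0\<close> by (rule tendstoD)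
  ultimately have "\<forall>\<^sub>F k in sequentially. \<mu> \<le> norm (V k)"
  proof eventually_elim
    case (elim k)
    obtain t where t: "\<phi> (X k) = ereal (c + t)"
    proof -
      have "\<phi> (X k) = ereal (c + (real_of_ereal (\<phi> (X k)) - c))"
        using finite_if_scaled_subgradient[OF VX[of k]] by auto
      thus ?thesis by (rule that)
    qed
    have tpos: "0 < t" using X(3)[of k] by (simp add: t c)
    obtain v where v: "v \<in> limiting_subdifferential \<phi> (X k)"
      and Vk: "V k = ((1 - \<theta>) * t powr - \<theta>) *\<^sub>R v"
      using VX[of k] by (auto simp: scaled_subdifferential_def t c)
    have "ereal (\<mu> / (1 - \<theta>) * t powr \<theta>) \<le> set_distance 0 (limiting_subdifferential \<phi> (X k))"
      using ineq[of "X k"] elim tpos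
      by (simp add: t c ereal_powr_def dist_norm max_def zero_ereal_def)
    also have "\<dots> \<le> ereal (norm v)"
      unfolding set_distance_def using v by (intro INF_lower2[OF v]) simp
    finally have "\<mu> / (1 - \<theta>) * t powr \<theta> \<le> norm v" by simp
    thus ?case using \<theta> tpos by (simp add: Vk powr_minus field_simps)
  qed
  thus ?thesis using tendsto_norm[OF V] by (intro tendsto_lowerbound) auto
qed

text \<open>Letting the modulus vary with the index covers two uses: \<open>\<mu>\<^sub>k \<rightarrow> 0\<close> exhibits \<open>0\<close> itself as an
  outer subgradient by a diagonal sequence, and a constant \<open>\<mu>\<^sub>k\<close> bounds the distance of \<open>0\<close> from the
  outer limit.\<close>

lemma not_KL_property_imp_outer_subgradient:
  fixes \<phi> :: "'a::euclidean_space \<Rightarrow> ereal"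
  assumes lsc: "locally_lsc_at \<phi> x0" and \<theta>: "0 \<le> \<theta>" "\<theta> < 1"
    and \<mu>: "\<And>k. \<mu> k > 0" "\<mu> \<longlonglongrightarrow> m" and notKL: "\<And>k. \<not> KL_property \<phi> x0 \<theta> (\<mu> k)"
  shows "\<exists>w \<in> limsup_from_above \<phi> x0 (scaled_subdifferential \<phi> x0 (1 - \<theta>)). norm w \<le> m"
proof -
  obtain c where c: "\<phi> x0 = ereal c" using lsc by (auto simp: locally_lsc_at_def)
  define e where "e k = 1 / real (Suc k)" for k
  have epos: "e k > 0" for k by (simp add: e_def)
  have elim0: "e \<longlonglongrightarrow> 0"
    unfolding e_def using LIMSEQ_inverse_real_of_nat by (simp add: inverse_eq_divide)
  have "\<exists>x t w. norm (x - x0) \<le> e k \<and> \<phi> x = ereal (c + t) \<and> 0 < t \<and> t < e k \<and>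
           w \<in> scaled_subdifferential \<phi> x0 (1 - \<theta>) x \<and> norm w \<le> \<mu> k" for k
  proof -
    have "ereal (e k) > 0" using epos by simp
    then obtain x where x: "norm (x - x0) \<le> e k" "\<phi> x < \<phi> x0 + ereal (e k)"
      and less: "set_distance 0 (limiting_subdifferential \<phi> x)
         < ereal (\<mu> k / (1 - \<theta>)) * ereal_powr (max (\<phi> x - \<phi> x0) 0) \<theta>"
      using notKL[of k] lsc \<theta> \<mu>(1)[of k] epos[of k] unfolding KL_property_def not_le[symmetric]
      by blast
    \<comment> \<open>Where \<open>\<phi> x \<le> \<phi> x0\<close> the right-hand side is \<open>0\<close> and the inequality could not fail.\<close>
    have "\<not> \<phi> x \<le> ereal c"
    proof
      assume "\<phi> x \<le> ereal c"
      hence "ereal_powr (max (\<phi> x - \<phi> x0) 0) \<theta> = 0"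
        using power_above_below[of \<phi> x c \<theta>] by (simp add: power_above_def c)
      thus False using less set_distance_nonneg[of 0 "limiting_subdifferential \<phi> x"] by simp
    qed
    then obtain s where s: "\<phi> x = ereal s" "c < s" "s < c + e k"
      using x(2) by (cases "\<phi> x") (auto simp: c)
    define t where "t = s - c"
    have t: "\<phi> x = ereal (c + t)" "0 < t" "t < e k" using s by (auto simp: t_def)
    have "set_distance 0 (limiting_subdifferential \<phi> x) < ereal (\<mu> k / (1 - \<theta>) * t powr \<theta>)"
      using less t by (simp add: c ereal_powr_def max_def zero_ereal_def)
    then obtain v where v: "v \<in> limiting_subdifferential \<phi> x"
      and lt: "norm v < \<mu> k / (1 - \<theta>) * t powr \<theta>"
      unfolding set_distance_def INF_less_iff by auto
    define w where "w = ((1 - \<theta>) * t powr - \<theta>) *\<^sub>R v"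
    have "w \<in> scaled_subdifferential \<phi> x0 (1 - \<theta>) x"
      using v by (auto simp: scaled_subdifferential_def t c w_def)
    moreover have "norm w \<le> \<mu> k"
      using lt \<theta> t(2) by (simp add: w_def powr_minus field_simps)
    ultimately show ?thesis using x(1) t by blast
  qed
  then obtain X t W where X: "\<And>k. norm (X k - x0) \<le> e k" and \<phi>X: "\<And>k. \<phi> (X k) = ereal (c + t k)"
    and t: "\<And>k. 0 < t k" "\<And>k. t k < e k" and W: "\<And>k. W k \<in> scaled_subdifferential \<phi> x0 (1 - \<theta>) (X k)"
    and norm_W: "\<And>k. norm (W k) \<le> \<mu> k"
    by metis
  have "(\<lambda>k. X k - x0) \<longlonglongrightarrow> 0" using X by (intro Lim_null_comparison[OF _ elim0]) auto
  hence Xlim: "X \<longlonglongrightarrow> x0" by (simp add: LIM_zero_iff)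
  have "t \<longlonglongrightarrow> 0"
    using t by (intro Lim_null_comparison[OF _ elim0]) (auto simp: less_imp_le)
  from tendsto_add[OF tendsto_const[of c] this]
  have \<phi>lim: "(\<lambda>k. \<phi> (X k)) \<longlonglongrightarrow> \<phi> x0" by (simp add: \<phi>X c)
  have "Bseq \<mu>" using \<mu>(2) by (intro convergent_imp_Bseq) (auto simp: convergent_def)
  then obtain K where "\<And>k. norm (\<mu> k) \<le> K" unfolding Bseq_def by blast
  hence "norm (W k) \<le> K" for k using norm_W[of k] abs_ge_self[of "\<mu> k"] order_trans
    by (metis real_norm_def)
  hence "bounded (range W)" by (auto simp: bounded_iff)
  then obtain w r where r: "strict_mono r" and Wlim: "(W \<circ> r) \<longlonglongrightarrow> w"
    using bounded_imp_convergent_subsequence by blast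
  have "(X \<circ> r) \<longlonglongrightarrow> x0" "(\<lambda>k. \<phi> ((X \<circ> r) k)) \<longlonglongrightarrow> \<phi> x0"
    using LIMSEQ_subseq_LIMSEQ[OF Xlim r] LIMSEQ_subseq_LIMSEQ[OF \<phi>lim r] by (simp_all add: o_def)
  moreover have "\<forall>k. \<phi> ((X \<circ> r) k) > \<phi> x0" using t(1) by (simp add: \<phi>X c)
  moreover have "\<forall>k. (W \<circ> r) k \<in> scaled_subdifferential \<phi> x0 (1 - \<theta>) ((X \<circ> r) k)"
    using W by simp
  ultimately have "w \<in> limsup_from_above \<phi> x0 (scaled_subdifferential \<phi> x0 (1 - \<theta>))"
    unfolding limsup_from_above_def using Wlim by blast
  moreover have "norm w \<le> m"
    by (rule LIMSEQ_le[OF tendsto_norm[OF Wlim] LIMSEQ_subseq_LIMSEQ[OF \<mu>(2) r]])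
       (simp add: norm_W)
  ultimately show ?thesis by blast
qed

lemma KL_exponent_iff_zero_notin:
  fixes \<phi> :: "'a::euclidean_space \<Rightarrow> ereal"
  assumes "locally_lsc_at \<phi> x0" "0 \<le> \<theta>" "\<theta> < 1"
  shows "KL_exponent \<phi> x0 \<theta> \<longleftrightarrow>
    0 \<notin> limsup_from_above \<phi> x0 (scaled_subdifferential \<phi> x0 (1 - \<theta>))" (is "_ \<longleftrightarrow> 0 \<notin> ?G")
proof
  assume "KL_exponent \<phi> x0 \<theta>"
  then obtain \<mu> where \<mu>: "KL_property \<phi> x0 \<theta> \<mu>" by (auto simp: KL_exponent_def)
  hence "\<mu> > 0" by (simp add: KL_property_def)
  thus "0 \<notin> ?G" using KL_property_imp_le_norm[OF \<mu>, of 0] by auto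
next
  assume 0: "0 \<notin> ?G"
  show "KL_exponent \<phi> x0 \<theta>"
  proof (rule ccontr)
    assume "\<not> KL_exponent \<phi> x0 \<theta>"
    hence "\<exists>w\<in>?G. norm w \<le> 0"
      using not_KL_property_imp_outer_subgradient[OF assms _ LIMSEQ_inverse_real_of_nat]
      by (auto simp: KL_exponent_def)
    thus False using 0 by simp
  qed
qed

lemma KL_modulus_eq_set_distance:
  fixes \<phi> :: "'a::euclidean_space \<Rightarrow> ereal"
  assumes "locally_lsc_at \<phi> x0" "0 \<le> \<theta>" "\<theta> < 1"
  shows "KL_modulus \<phi> x0 \<theta> =
    set_distance 0 (limsup_from_above \<phi> x0 (scaled_subdifferential \<phi> x0 (1 - \<theta>)))"
    (is "_ = set_distance 0 ?G")
proof (rule antisym)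
  show "KL_modulus \<phi> x0 \<theta> \<le> set_distance 0 ?G"
    unfolding KL_modulus_def
  proof (rule Sup_least)
    fix z assume "z \<in> insert 0 {ereal \<mu> |\<mu>. KL_property \<phi> x0 \<theta> \<mu>}"
    thus "z \<le> set_distance 0 ?G"
      by (auto simp: set_distance_nonneg)
         (auto simp: set_distance_def intro!: INF_greatest KL_property_imp_le_norm)
  qed
next
  show "set_distance 0 ?G \<le> KL_modulus \<phi> x0 \<theta>"
  proof (rule ereal_le_real)
    show "set_distance 0 ?G \<le> ereal z" if "KL_modulus \<phi> x0 \<theta> \<le> ereal z" for z
    proof (rule ereal_le_epsilon2)
      fix e :: real assume e: "0 < e"
      have "ereal 0 \<le> KL_modulus \<phi> x0 \<theta>"
        unfolding KL_modulus_def zero_ereal_def[symmetric] by (rule Sup_upper) simp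
      hence z: "0 \<le> z" using that by (metis ereal_less_eq(3) order_trans)
      have "\<not> KL_property \<phi> x0 \<theta> (z + e)"
      proof
        assume "KL_property \<phi> x0 \<theta> (z + e)"
        hence "ereal (z + e) \<le> KL_modulus \<phi> x0 \<theta>"
          unfolding KL_modulus_def by (intro Sup_upper) auto
        hence "ereal (z + e) \<le> ereal z" using that by (rule order_trans)
        thus False using e by simp
      qed
      then obtain w where "w \<in> ?G" "norm w \<le> z + e"
        using not_KL_property_imp_outer_subgradient[OF assms _ tendsto_const, of "z + e"] z e by auto
      thus "set_distance 0 ?G \<le> ereal z + ereal e"
        unfolding set_distance_def by (intro INF_lower2[of w]) auto
    qed
  qed
qed

section \<open>Outer subgradients of powers and the KL property\<close>

theorem theorem2p5:
  fixes f g :: "real ^ 'n \<Rightarrow> ereal" and xbar :: "real ^ 'n" and \<theta> :: real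
  assumes "\<bar>f xbar\<bar> \<noteq> \<infinity>" and "locally_lsc_at f xbar"
    and "0 \<le> \<theta>" and "\<theta> < 1"
    and "g = (\<lambda>x. ereal_powr (max (f x - f xbar) 0) (1 - \<theta>))"
  shows "outer_subdifferential g xbar =
           limsup_from_above f xbar
             (\<lambda>x. (\<lambda>v. ((1 - \<theta>) / real_of_ereal (f x - f xbar) powr \<theta>) *\<^sub>R v)
                     ` limiting_subdifferential f x) \<and>
         (KL_exponent f xbar \<theta> \<longleftrightarrow> 0 \<notin> outer_subdifferential g xbar) \<and>
         (outer_subdifferential g xbar \<noteq> {} \<longrightarrow>
           (\<forall>\<theta>t<\<theta>. 0 \<in> outer_subdifferential
              (\<lambda>x. ereal_powr (max (f x - f xbar) 0) (1 - \<theta>t)) xbar)) \<and>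
         (0 \<notin> outer_subdifferential g xbar \<and> outer_subdifferential g xbar \<noteq> {} \<longrightarrow>
           sharp_KL_exponent f xbar \<theta>) \<and>
         KL_modulus f xbar \<theta> = set_distance 0 (outer_subdifferential g xbar)"
proof -
  define G where "G \<eta> = limsup_from_above f xbar (scaled_subdifferential f xbar (1 - \<eta>))" for \<eta>
  have outer: "outer_subdifferential (\<lambda>x. ereal_powr (max (f x - f xbar) 0) (1 - \<eta>)) xbar = G \<eta>"
    if "\<eta> < 1" for \<eta>
    using outer_subdifferential_power_above[of "1 - \<eta>" f xbar] that assms(1)
    by (simp add: G_def power_above_def[abs_def])
  have g: "outer_subdifferential g xbar = G \<theta>" using outer assms(4,5) by simp
  have G_eq: "G \<theta> = limsup_from_above f xbar
      (\<lambda>x. (\<lambda>v. ((1 - \<theta>) / real_of_ereal (f x - f xbar) powr \<theta>) *\<^sub>R v)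
              ` limiting_subdifferential f x)"
    by (simp add: G_def scaled_subdifferential_def[abs_def] powr_minus_divide)
  have a: "KL_exponent f xbar \<eta> \<longleftrightarrow> 0 \<notin> G \<eta>" if "0 \<le> \<eta>" "\<eta> < 1" for \<eta>
    unfolding G_def using assms(2) that by (rule KL_exponent_iff_zero_notin)
  have b: "0 \<in> G \<eta>" if "G \<theta> \<noteq> {}" "\<eta> < \<theta>" for \<eta>
    using that assms unfolding G_def
    by (intro zero_in_limsup_scaled_subdifferential[of "1 - \<theta>"]) auto
  have c: "sharp_KL_exponent f xbar \<theta>" if 0: "0 \<notin> G \<theta>" and ne: "G \<theta> \<noteq> {}"
  proof (cases "\<theta> = 0")
    case True
    \<comment> \<open>Exponent \<open>1\<close> leaves the subgradients of \<open>f\<close> above the level \<open>f xbar\<close> unscaled.\<close>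
    have "G \<theta> \<subseteq> outer_subdifferential f xbar"
    proof
      fix w assume "w \<in> G \<theta>"
      then obtain X V where XV: "X \<longlonglongrightarrow> xbar" "(\<lambda>k. f (X k)) \<longlonglongrightarrow> f xbar" "\<forall>k. f (X k) > f xbar"
        "V \<longlonglongrightarrow> w" and V: "\<And>k. V k \<in> scaled_subdifferential f xbar 1 (X k)"
        unfolding G_def limsup_from_above_def True by auto
      have "V k \<in> limiting_subdifferential f (X k)" for k
      proof -
        have "real_of_ereal (f (X k) - f xbar) \<noteq> 0"
          using XV(3) assms(1) finite_if_scaled_subgradient[OF V[of k]]
          by (cases "f (X k)"; cases "f xbar") (auto dest: spec[of _ k])
        thus ?thesis using V[of k] by (auto simp: scaled_subdifferential_def)
      qed
      thus "w \<in> outer_subdifferential f xbar"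
        using XV assms(1) unfolding outer_subdifferential_def limsup_from_above_def by auto
    qed
    thus ?thesis using ne 0 True a[of \<theta>] by (auto simp: sharp_KL_exponent_def)
  next
    case False
    thus ?thesis using 0 a b[OF ne] assms(3,4) by (auto simp: sharp_KL_exponent_def)
  qed
  have d: "KL_modulus f xbar \<theta> = set_distance 0 (G \<theta>)"
    unfolding G_def using assms(2-4) by (rule KL_modulus_eq_set_distance)
  show ?thesis
    unfolding g using G_eq a[OF assms(3,4)] b c d outer assms(4) by auto
qed

end
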